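(* Let $S$ be a multiplicative subset of a commutative ring $R$ with nonzero identity. For each $i=1,2,\dots,n$, let $M_i$ be an $R$-module and $K_i\leq M_i$ a submodule. Then $\bigoplus_{i=1}^{n}K_i$ is $u$-$S$-essential in $\bigoplus_{i=1}^{n}M_i$ if and only if $K_i$ is $u$-$S$-essential in $M_i$ for each $i=1,2,\dots,n$.
   Context: A multiplicative subset $S$ of $R$ satisfies $1\in S$, $0\notin S$, and $s_1s_2\in S$ for all $s_1,s_2\in S$. All modules are unitary. An $R$-module $X$ is $u$-$S$-torsion if there exists $s\in S$ with $sX=0$. A submodule $N$ of $M$ is $u$-$S$-essential in $M$ if for every submodule $L$ of $M$, $N\cap L$ being $u$-$S$-torsion implies that $L$ is $u$-$S$-torsion. *)

theory Defs
  imports "HOL-Algebra.Module"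
begin

definition mult_subset :: "('a, 'r) ring_scheme \<Rightarrow> 'a set \<Rightarrow> bool"
  where "mult_subset R S \<longleftrightarrow>
    S \<subseteq> carrier R \<and> \<one>\<^bsub>R\<^esub> \<in> S \<and> \<zero>\<^bsub>R\<^esub> \<notin> S \<and> (\<forall>s\<in>S. \<forall>t\<in>S. s \<otimes>\<^bsub>R\<^esub> t \<in> S)"

definition uS_torsion :: "'a set \<Rightarrow> ('a, 'b, 'm) module_scheme \<Rightarrow> bool"
  where "uS_torsion S X \<longleftrightarrow> (\<exists>s\<in>S. \<forall>x\<in>carrier X. s \<odot>\<^bsub>X\<^esub> x = \<zero>\<^bsub>X\<^esub>)"

text \<open>
  A submodule \<open>N\<close> is, as in \<open>HOL-Algebra\<close>, a subset of the carrier of \<open>M\<close>; regarded as a module in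
  its own right it is \<open>M\<lparr>carrier := N\<rparr>\<close>.
\<close>

definition uS_essential ::
  "('a, 'r) ring_scheme \<Rightarrow> 'a set \<Rightarrow> 'b set \<Rightarrow> ('a, 'b, 'm) module_scheme \<Rightarrow> bool"
  where "uS_essential R S N M \<longleftrightarrow> submodule N R M \<and>
    (\<forall>L. submodule L R M \<longrightarrow>
      uS_torsion S (M\<lparr>carrier := N \<inter> L\<rparr>) \<longrightarrow> uS_torsion S (M\<lparr>carrier := L\<rparr>))"

text \<open>
  External direct sum: families of finite support with pointwise operations, extended by
  \<open>undefined\<close> outside \<open>I\<close>.  The module record extends the ring record, so \<open>mult\<close> and \<open>one\<close> must be
  filled in; the locale \<^locale>\<open>module\<close> does not constrain them.
\<close>

definition module_direct_sum ::
  "'i set \<Rightarrow> ('i \<Rightarrow> ('a, 'b, 'm) module_scheme) \<Rightarrow> ('a, 'i \<Rightarrow> 'b) module"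
  where "module_direct_sum I M =
    \<lparr>carrier = {x \<in> \<Pi>\<^sub>E i\<in>I. carrier (M i). finite {i \<in> I. x i \<noteq> \<zero>\<^bsub>M i\<^esub>}},
     mult = undefined,
     one = undefined,
     zero = (\<lambda>i\<in>I. \<zero>\<^bsub>M i\<^esub>),
     add = (\<lambda>x y. \<lambda>i\<in>I. x i \<oplus>\<^bsub>M i\<^esub> y i),
     smult = (\<lambda>a x. \<lambda>i\<in>I. a \<odot>\<^bsub>M i\<^esub> x i)\<rparr>"

lemma module_direct_sum_module:
  assumes R: "cring R" and M: "\<And>i. i \<in> I \<Longrightarrow> module R (M i)"
  shows "module R (module_direct_sum I M)"
proof (rule moduleI)
  note ag = M[THEN module.axioms(2)]
  note am = ag[THEN abelian_group.axioms(1)]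
  show "cring R" by (rule R)
  have fin_add: "finite {i \<in> I. x i \<oplus>\<^bsub>M i\<^esub> y i \<noteq> \<zero>\<^bsub>M i\<^esub>}"
    if "finite {i \<in> I. x i \<noteq> \<zero>\<^bsub>M i\<^esub>}" "finite {i \<in> I. y i \<noteq> \<zero>\<^bsub>M i\<^esub>}" for x y
    by (rule finite_subset[OF _ finite_UnI[OF that]])
      (auto simp: abelian_monoid.l_zero[OF am] abelian_monoid.zero_closed[OF am])
  have fin_smult: "finite {i \<in> I. a \<odot>\<^bsub>M i\<^esub> x i \<noteq> \<zero>\<^bsub>M i\<^esub>}"
    if "finite {i \<in> I. x i \<noteq> \<zero>\<^bsub>M i\<^esub>}" "a \<in> carrier R" for a x
    by (rule finite_subset[OF _ that(1)]) (use that(2) in \<open>auto simp: module.smult_r_null[OF M]\<close>)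
  have fin_minus: "finite {i \<in> I. \<ominus>\<^bsub>M i\<^esub> x i \<noteq> \<zero>\<^bsub>M i\<^esub>}"
    if "finite {i \<in> I. x i \<noteq> \<zero>\<^bsub>M i\<^esub>}" for x
    by (rule finite_subset[OF _ that])
      (use monoid.inv_one[OF group.is_monoid, OF abelian_group.a_group[OF ag]] in \<open>auto simp: a_inv_def\<close>)
  have restrictI: "(\<lambda>i\<in>I. f i) \<in> carrier (module_direct_sum I M)"
    if "\<And>i. i \<in> I \<Longrightarrow> f i \<in> carrier (M i)" "finite {i \<in> I. f i \<noteq> \<zero>\<^bsub>M i\<^esub>}" for f
  proof -
    have "{i \<in> I. (\<lambda>i\<in>I. f i) i \<noteq> \<zero>\<^bsub>M i\<^esub>} = {i \<in> I. f i \<noteq> \<zero>\<^bsub>M i\<^esub>}"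
      by auto
    with that show ?thesis
      unfolding module_direct_sum_def by (simp del: restrict_apply)
  qed
  have memD: "x i \<in> carrier (M i)" "finite {i \<in> I. x i \<noteq> \<zero>\<^bsub>M i\<^esub>}"
    if "x \<in> carrier (module_direct_sum I M)" "i \<in> I" for x i
    using that by (auto simp: module_direct_sum_def PiE_iff)
  have fin: "finite {i \<in> I. x i \<noteq> \<zero>\<^bsub>M i\<^esub>}" if "x \<in> carrier (module_direct_sum I M)" for x
    using that by (simp add: module_direct_sum_def)
  have add: "x \<oplus>\<^bsub>module_direct_sum I M\<^esub> y = (\<lambda>i\<in>I. x i \<oplus>\<^bsub>M i\<^esub> y i)"
    and zero: "\<zero>\<^bsub>module_direct_sum I M\<^esub> = (\<lambda>i\<in>I. \<zero>\<^bsub>M i\<^esub>)"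
    and smult: "a \<odot>\<^bsub>module_direct_sum I M\<^esub> x = (\<lambda>i\<in>I. a \<odot>\<^bsub>M i\<^esub> x i)" for x y a
    by (simp_all add: module_direct_sum_def)
  show "abelian_group (module_direct_sum I M)"
  proof (rule abelian_groupI)
    fix x assume x: "x \<in> carrier (module_direct_sum I M)"
    have "(\<lambda>i\<in>I. \<ominus>\<^bsub>M i\<^esub> x i) \<in> carrier (module_direct_sum I M)"
      using x by (intro restrictI fin_minus fin) (auto intro: abelian_group.a_inv_closed[OF ag] memD)
    moreover have "(\<lambda>i\<in>I. \<ominus>\<^bsub>M i\<^esub> x i) \<oplus>\<^bsub>module_direct_sum I M\<^esub> x = \<zero>\<^bsub>module_direct_sum I M\<^esub>"
      using x by (auto simp: add zero memD abelian_group.l_neg[OF ag] fun_eq_iff)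
    ultimately show "\<exists>y\<in>carrier (module_direct_sum I M).
        y \<oplus>\<^bsub>module_direct_sum I M\<^esub> x = \<zero>\<^bsub>module_direct_sum I M\<^esub>"
      by blast
  next
    fix x y assume "x \<in> carrier (module_direct_sum I M)" "y \<in> carrier (module_direct_sum I M)"
    then show "x \<oplus>\<^bsub>module_direct_sum I M\<^esub> y \<in> carrier (module_direct_sum I M)"
      unfolding add
      by (intro restrictI fin_add fin) (auto intro: abelian_monoid.a_closed[OF am] memD)
  next
    show "\<zero>\<^bsub>module_direct_sum I M\<^esub> \<in> carrier (module_direct_sum I M)"
      unfolding zero by (rule restrictI) (auto intro: abelian_monoid.zero_closed[OF am])
  qed (auto simp: module_direct_sum_def PiE_iff fun_eq_iff extensional_def
      abelian_monoid.a_assoc[OF am] abelian_monoid.a_comm[OF am] abelian_monoid.l_zero[OF am])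
  show "a \<odot>\<^bsub>module_direct_sum I M\<^esub> x \<in> carrier (module_direct_sum I M)"
    if "a \<in> carrier R" "x \<in> carrier (module_direct_sum I M)" for a x
    using that unfolding smult
    by (intro restrictI fin_smult fin) (auto intro: module.smult_closed[OF M] memD)
qed (auto simp: module_direct_sum_def PiE_iff fun_eq_iff extensional_def
    module.smult_l_distr[OF M] module.smult_r_distr[OF M] module.smult_assoc1[OF M]
    module.smult_one[OF M])


lemma submodule_module_direct_sum:
  assumes R: "cring R" and M: "\<And>i. i \<in> I \<Longrightarrow> module R (M i)"
    and K: "\<And>i. i \<in> I \<Longrightarrow> submodule (K i) R (M i)"
  shows "submodule (carrier (module_direct_sum I (\<lambda>i. (M i)\<lparr>carrier := K i\<rparr>))) R
    (module_direct_sum I M)"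
proof -
  let ?D = "module_direct_sum I M" and ?N = "module_direct_sum I (\<lambda>i. (M i)\<lparr>carrier := K i\<rparr>)"
  interpret D: module R ?D
    by (rule module_direct_sum_module[OF R M])
  interpret N: module R ?N
    by (rule module_direct_sum_module[OF R]) (rule submodule.submodule_is_module[OF K M])
  have eq: "\<zero>\<^bsub>?N\<^esub> = \<zero>\<^bsub>?D\<^esub>" "add ?N = add ?D" "smult ?N = smult ?D"
    by (simp_all add: module_direct_sum_def)
  have sub: "carrier ?N \<subseteq> carrier ?D"
    using subgroup.subset[OF submodule.axioms(1)[OF K]]
    by (fastforce simp: module_direct_sum_def PiE_iff)
  show ?thesis
  proof (rule D.submoduleI)
    fix x assume x: "x \<in> carrier ?N"
    have "\<ominus>\<^bsub>?N\<^esub> x \<oplus>\<^bsub>?D\<^esub> x = \<zero>\<^bsub>?D\<^esub>"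
      using N.M.l_neg[OF x] by (simp add: eq)
    then have "\<ominus>\<^bsub>?D\<^esub> x = \<ominus>\<^bsub>?N\<^esub> x"
      using sub x N.M.a_inv_closed[OF x] by (intro D.M.minus_equality) auto
    then show "\<ominus>\<^bsub>?D\<^esub> x \<in> carrier ?N"
      using N.M.a_inv_closed[OF x] by simp
  qed (use sub N.M.zero_closed N.M.a_closed N.smult_closed in \<open>auto simp: eq\<close>)
qed

end

(* u-S-essential submodules are stable under preimages along module homomorphisms and under finite
   intersections. The submodule of families with values in K is the intersection of the preimages
   of the K i under the projections, and conversely each K i is the preimage of that submodule
   under the i-th injection. *)
theory Submission
  imports Defs
begin

lemma uS_torsion_submodule_iff:
  "uS_torsion S (M\<lparr>carrier := L\<rparr>) \<longleftrightarrow> (\<exists>s\<in>S. \<forall>x\<in>L. s \<odot>\<^bsub>M\<^esub> x = \<zero>\<^bsub>M\<^esub>)"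
  by (simp add: uS_torsion_def)

text \<open>Closure under negation comes for free, since -x is the scalar multiple of x by
  -1.\<close>

lemma (in module) submoduleI_smult:
  assumes "H \<subseteq> carrier M" and "\<zero>\<^bsub>M\<^esub> \<in> H"
    and "\<And>x y. x \<in> H \<Longrightarrow> y \<in> H \<Longrightarrow> x \<oplus>\<^bsub>M\<^esub> y \<in> H"
    and smult: "\<And>a x. a \<in> carrier R \<Longrightarrow> x \<in> H \<Longrightarrow> a \<odot>\<^bsub>M\<^esub> x \<in> H"
  shows "submodule H R M"
proof (rule submoduleI)
  fix x assume x: "x \<in> H"
  then have "\<ominus>\<^bsub>M\<^esub> x = (\<ominus>\<^bsub>R\<^esub> \<one>\<^bsub>R\<^esub>) \<odot>\<^bsub>M\<^esub> x"
    using assms(1) by (subst smult_l_minus) auto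
  then show "\<ominus>\<^bsub>M\<^esub> x \<in> H"
    using smult[of "\<ominus>\<^bsub>R\<^esub> \<one>\<^bsub>R\<^esub>" x] x by simp
qed (use assms in auto)

lemma (in module) submodule_zero_closed:
  assumes "submodule H R M" shows "\<zero>\<^bsub>M\<^esub> \<in> H"
  using subgroup.one_closed[OF submodule.axioms(1)[OF assms]] by simp

lemma (in module) submodule_Int:
  assumes "submodule H R M" "submodule N R M"
  shows "submodule (H \<inter> N) R M"
  using submoduleE(1,4,5)[OF assms(1)] submoduleE(1,4,5)[OF assms(2)]
    submodule_zero_closed[OF assms(1)] submodule_zero_closed[OF assms(2)]
  by (intro submoduleI_smult) auto

lemma (in module) uS_essential_carrier: "uS_essential R S (carrier M) M"
  unfolding uS_essential_def
  by (metis carrier_is_submodule inf.absorb2 submoduleE(1))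

text \<open>Reassociate (H \<inter> N) \<inter> L as H \<inter> (N \<inter> L). If it is torsion,
  essentiality of \<open>H\<close> tested on the submodule N \<inter> L makes N \<inter> L torsion,
  and then essentiality of \<open>N\<close> tested on \<open>L\<close> makes \<open>L\<close>
  torsion.\<close>

lemma (in module) uS_essential_Int:
  assumes "uS_essential R S H M" "uS_essential R S N M"
  shows "uS_essential R S (H \<inter> N) M"
  unfolding uS_essential_def Int_assoc
  using assms submodule_Int unfolding uS_essential_def by blast

locale module_hom = A: module R A + B: module R B
  for R (structure) and A (structure) and B (structure) +
  fixes f
  assumes hom_closed: "x \<in> carrier A \<Longrightarrow> f x \<in> carrier B"
    and hom_add: "x \<in> carrier A \<Longrightarrow> y \<in> carrier A \<Longrightarrow> f (x \<oplus>\<^bsub>A\<^esub> y) = f x \<oplus>\<^bsub>B\<^esub> f y"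
    and hom_smult: "a \<in> carrier R \<Longrightarrow> x \<in> carrier A \<Longrightarrow> f (a \<odot>\<^bsub>A\<^esub> x) = a \<odot>\<^bsub>B\<^esub> f x"
begin

text \<open>Applying \<open>hom_smult\<close> to the scalar 0 and the vector 0 turns the value at
  zero into 0 times something.\<close>

lemma hom_zero: "f \<zero>\<^bsub>A\<^esub> = \<zero>\<^bsub>B\<^esub>"
  using hom_smult[of "\<zero>\<^bsub>R\<^esub>" "\<zero>\<^bsub>A\<^esub>"] hom_closed[of "\<zero>\<^bsub>A\<^esub>"] by simp

lemma submodule_image:
  assumes L: "submodule L R A"
  shows "submodule (f ` L) R B"
proof -
  note L' = A.submoduleE[OF L] A.submodule_zero_closed[OF L]
  show ?thesis
  proof (rule B.submoduleI_smult)
    show "f ` L \<subseteq> carrier B"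
      using L'(1) hom_closed by blast
    show "\<zero>\<^bsub>B\<^esub> \<in> f ` L"
      using L'(7) hom_zero by (metis imageI)
    fix x y assume "x \<in> f ` L" "y \<in> f ` L"
    then show "x \<oplus>\<^bsub>B\<^esub> y \<in> f ` L"
      using L'(1,5) hom_add by (smt (verit) imageE imageI subsetD)
  next
    fix a x assume "a \<in> carrier R" "x \<in> f ` L"
    then show "a \<odot>\<^bsub>B\<^esub> x \<in> f ` L"
      using L'(1,4) hom_smult by (smt (verit) imageE imageI subsetD)
  qed
qed

lemma submodule_vimage:
  assumes K: "submodule K R B"
  shows "submodule {x \<in> carrier A. f x \<in> K} R A"
  using B.submoduleE(4,5)[OF K] B.submodule_zero_closed[OF K]
  by (intro A.submoduleI_smult) (auto simp: hom_add hom_smult hom_zero)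

text \<open>If \<open>s\<close> kills the part of \<open>L\<close> lying in the preimage of
  \<open>K\<close>, then it kills the intersection of \<open>K\<close> with f(L), so some
  \<open>t\<close> kills f(L). Hence tL lies in the kernel of \<open>f\<close>, which is contained
  in the preimage of \<open>K\<close>. As tL also lies in \<open>L\<close>, it is killed by
  \<open>s\<close>, and the product of \<open>s\<close> and \<open>t\<close> kills
  \<open>L\<close>.\<close>

lemma uS_essential_vimage:
  assumes S: "S \<subseteq> carrier R" "\<And>s t. s \<in> S \<Longrightarrow> t \<in> S \<Longrightarrow> s \<otimes>\<^bsub>R\<^esub> t \<in> S"
    and K: "uS_essential R S K B"
  shows "uS_essential R S {x \<in> carrier A. f x \<in> K} A" (is "uS_essential R S ?N A")
  unfolding uS_essential_def uS_torsion_submodule_iff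
proof (intro conjI allI impI)
  have subK: "submodule K R B"
    using K by (simp add: uS_essential_def)
  then show "submodule ?N R A"
    by (rule submodule_vimage)
  fix L assume L: "submodule L R A" and "\<exists>s\<in>S. \<forall>x\<in>?N \<inter> L. s \<odot>\<^bsub>A\<^esub> x = \<zero>\<^bsub>A\<^esub>"
  then obtain s where s: "s \<in> S" "\<And>x. x \<in> ?N \<Longrightarrow> x \<in> L \<Longrightarrow> s \<odot>\<^bsub>A\<^esub> x = \<zero>\<^bsub>A\<^esub>"
    by blast
  note L' = A.submoduleE[OF L]
  \<comment> \<open>The same \<open>s\<close> serves for the intersection of \<open>K\<close> with
    f(L): every element there is some \<open>f x\<close> with \<open>x\<close> in \<open>L\<close>,
    and such an \<open>x\<close> lies in the preimage of \<open>K\<close>.\<close>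
  have "s \<odot>\<^bsub>B\<^esub> f x = \<zero>\<^bsub>B\<^esub>" if "f x \<in> K" "x \<in> L" for x
  proof -
    have "s \<odot>\<^bsub>A\<^esub> x = \<zero>\<^bsub>A\<^esub>" "s \<in> carrier R" "x \<in> carrier A"
      using s S(1) L'(1) that by blast+
    then show ?thesis
      using hom_smult[of s x] hom_zero by simp
  qed
  then have "uS_torsion S (B\<lparr>carrier := K \<inter> f ` L\<rparr>)"
    unfolding uS_torsion_submodule_iff using s(1) by blast
  then have "uS_torsion S (B\<lparr>carrier := f ` L\<rparr>)"
    using K submodule_image[OF L] by (simp add: uS_essential_def)
  then obtain t where t: "t \<in> S" "\<And>x. x \<in> L \<Longrightarrow> t \<odot>\<^bsub>B\<^esub> f x = \<zero>\<^bsub>B\<^esub>"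
    unfolding uS_torsion_submodule_iff by blast
  have "(s \<otimes>\<^bsub>R\<^esub> t) \<odot>\<^bsub>A\<^esub> x = \<zero>\<^bsub>A\<^esub>" if x: "x \<in> L" for x
  proof -
    have cl: "x \<in> carrier A" "s \<in> carrier R" "t \<in> carrier R"
      using x L'(1) S(1) s(1) t(1) by auto
    \<comment> \<open>This multiple of \<open>x\<close> is mapped to zero, and zero belongs to
      \<open>K\<close>.\<close>
    have "t \<odot>\<^bsub>A\<^esub> x \<in> ?N"
      using cl x t(2) B.submodule_zero_closed[OF subK] by (simp add: hom_smult)
    then have "s \<odot>\<^bsub>A\<^esub> (t \<odot>\<^bsub>A\<^esub> x) = \<zero>\<^bsub>A\<^esub>"
      using s(2) L'(4) cl(3) x by blast
    then show ?thesis
      using cl by (simp add: A.smult_assoc1)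
  qed
  then show "\<exists>s\<in>S. \<forall>x\<in>L. s \<odot>\<^bsub>A\<^esub> x = \<zero>\<^bsub>A\<^esub>"
    using S(2)[OF s(1) t(1)] by blast
qed

end

lemma module_hom_proj:
  assumes "cring R" and M: "\<And>i. i \<in> I \<Longrightarrow> module R (M i)" and "i \<in> I"
  shows "module_hom R (module_direct_sum I M) (M i) (\<lambda>x. x i)"
proof -
  interpret D: module R "module_direct_sum I M"
    by (rule module_direct_sum_module) (use assms in auto)
  interpret Mi: module R "M i"
    using assms by blast
  show ?thesis
    by unfold_locales (use \<open>i \<in> I\<close> in \<open>auto simp: module_direct_sum_def\<close>)
qed

text \<open>The canonical injection of the i-th summand. Restricting the function to
  \<open>I\<close> makes it \<open>undefined\<close> elsewhere, as the extensional carrier of the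
  direct sum requires.\<close>

definition direct_sum_inj ::
  "'i set \<Rightarrow> ('i \<Rightarrow> ('a, 'b, 'm) module_scheme) \<Rightarrow> 'i \<Rightarrow> 'b \<Rightarrow> 'i \<Rightarrow> 'b"
  where "direct_sum_inj I M i x = (\<lambda>k\<in>I. if k = i then x else \<zero>\<^bsub>M k\<^esub>)"

text \<open>The support is contained in {i} and every other coordinate is a zero, which lies in
  \<open>K k\<close>, so only coordinate \<open>i\<close> matters. With \<open>K k\<close> the full
  carrier of \<open>M k\<close> this gives closedness of the injection; with submodules it computes
  the preimage of their direct sum.\<close>

lemma direct_sum_inj_in_carrier_iff:
  assumes "\<And>k. k \<in> I \<Longrightarrow> \<zero>\<^bsub>M k\<^esub> \<in> K k" and "i \<in> I"
  shows "direct_sum_inj I M i x \<in> carrier (module_direct_sum I (\<lambda>k. (M k)\<lparr>carrier := K k\<rparr>))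
    \<longleftrightarrow> x \<in> K i"
proof -
  have "finite {k \<in> I. direct_sum_inj I M i x k \<noteq> \<zero>\<^bsub>M k\<^esub>}"
    by (rule finite_subset[of _ "{i}"]) (auto simp: direct_sum_inj_def)
  then show ?thesis
    using assms by (auto simp: module_direct_sum_def direct_sum_inj_def PiE_iff)
qed

lemma module_hom_direct_sum_inj:
  assumes "cring R" and M: "\<And>i. i \<in> I \<Longrightarrow> module R (M i)" and i: "i \<in> I"
  shows "module_hom R (M i) (module_direct_sum I M) (direct_sum_inj I M i)"
proof -
  interpret D: module R "module_direct_sum I M"
    by (rule module_direct_sum_module) (use assms in auto)
  interpret Mi: module R "M i"
    using assms by blast
  \<comment> \<open>At coordinates other than \<open>i\<close> the homomorphism laws reduce to these
    identities about zero.\<close>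
  have zero: "\<zero>\<^bsub>M k\<^esub> \<in> carrier (M k)" "\<zero>\<^bsub>M k\<^esub> \<oplus>\<^bsub>M k\<^esub> \<zero>\<^bsub>M k\<^esub> = \<zero>\<^bsub>M k\<^esub>"
    "\<And>a. a \<in> carrier R \<Longrightarrow> a \<odot>\<^bsub>M k\<^esub> \<zero>\<^bsub>M k\<^esub> = \<zero>\<^bsub>M k\<^esub>" if "k \<in> I" for k
  proof -
    interpret Mk: module R "M k"
      using M that .
    show "\<zero>\<^bsub>M k\<^esub> \<in> carrier (M k)" "\<zero>\<^bsub>M k\<^esub> \<oplus>\<^bsub>M k\<^esub> \<zero>\<^bsub>M k\<^esub> = \<zero>\<^bsub>M k\<^esub>"
      "\<And>a. a \<in> carrier R \<Longrightarrow> a \<odot>\<^bsub>M k\<^esub> \<zero>\<^bsub>M k\<^esub> = \<zero>\<^bsub>M k\<^esub>"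
      by simp_all
  qed
  show ?thesis
  proof
    fix x assume "x \<in> carrier (M i)"
    then show "direct_sum_inj I M i x \<in> carrier (module_direct_sum I M)"
      using direct_sum_inj_in_carrier_iff[of I M "\<lambda>k. carrier (M k)" i x] zero i by simp
  qed (auto simp: direct_sum_inj_def module_direct_sum_def fun_eq_iff zero)
qed

theorem uS_essential_module_direct_sum_iff:
  assumes R: "cring R" and S: "mult_subset R S" and I: "finite I"
    and M: "\<And>i. i \<in> I \<Longrightarrow> module R (M i)"
    and K: "\<And>i. i \<in> I \<Longrightarrow> submodule (K i) R (M i)"
  shows "uS_essential R S (carrier (module_direct_sum I (\<lambda>i. (M i)\<lparr>carrier := K i\<rparr>)))
      (module_direct_sum I M) \<longleftrightarrow> (\<forall>i\<in>I. uS_essential R S (K i) (M i))"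
    (is "uS_essential R S ?N ?D \<longleftrightarrow> _")
proof (intro iffI ballI)
  have S': "S \<subseteq> carrier R" "\<And>s t. s \<in> S \<Longrightarrow> t \<in> S \<Longrightarrow> s \<otimes>\<^bsub>R\<^esub> t \<in> S"
    using S by (auto simp: mult_subset_def)
  have Ksub: "K i \<subseteq> carrier (M i)" "\<zero>\<^bsub>M i\<^esub> \<in> K i" if "i \<in> I" for i
    using module.submoduleE(1)[OF M K] module.submodule_zero_closed[OF M K] that by auto
  {
    fix i assume N: "uS_essential R S ?N ?D" and i: "i \<in> I"
    \<comment> \<open>The preimage under the i-th injection is exactly \<open>K i\<close>, so
      stability under preimages applies directly.\<close>
    have "{x \<in> carrier (M i). direct_sum_inj I M i x \<in> ?N} = K i"
      using direct_sum_inj_in_carrier_iff[of I M K i] Ksub i by auto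
    with module_hom.uS_essential_vimage[OF module_hom_direct_sum_inj[OF R M i] S' N]
    show "uS_essential R S (K i) (M i)"
      by simp
  next
    assume ess: "\<forall>i\<in>I. uS_essential R S (K i) (M i)"
    interpret D: module R ?D
      by (rule module_direct_sum_module[OF R M])
    \<comment> \<open>The ambient sum stays indexed by \<open>I\<close>; only the set
      \<open>J\<close> of constrained coordinates grows. For empty \<open>J\<close> the set is the
      whole carrier, and adding \<open>j\<close> intersects with the preimage of \<open>K j\<close>
      under the j-th projection.\<close>
    have "uS_essential R S {x \<in> carrier ?D. \<forall>i\<in>J. x i \<in> K i} ?D" if "finite J" "J \<subseteq> I" for J
      using that
    proof (induction J rule: finite_induct)
      case empty
      show ?case
        by (simp add: D.uS_essential_carrier)
    next
      case (insert j J)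
      then have j: "j \<in> I"
        by simp
      have "uS_essential R S {x \<in> carrier ?D. x j \<in> K j} ?D"
        by (rule module_hom.uS_essential_vimage[OF module_hom_proj[where I = I and M = M] S'])
          (use R M ess j in auto)
      moreover have "{x \<in> carrier ?D. x j \<in> K j} \<inter> {x \<in> carrier ?D. \<forall>i\<in>J. x i \<in> K i} =
          {x \<in> carrier ?D. \<forall>i\<in>insert j J. x i \<in> K i}"
        by auto
      ultimately show ?case
        using D.uS_essential_Int[of S "{x \<in> carrier ?D. x j \<in> K j}"] insert by fastforce
    qed
    \<comment> \<open>Shrinking the carriers to \<open>K i\<close> leaves the zeros unchanged, so
      the finite-support condition is the same on both sides.\<close>
    moreover have "{x \<in> carrier ?D. \<forall>i\<in>I. x i \<in> K i} = ?N"
      using Ksub by (fastforce simp: module_direct_sum_def PiE_iff)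
    ultimately show "uS_essential R S ?N ?D"
      using I by fastforce
  }
qed

theorem corollary2p22:
  fixes R :: "('a, 'r) ring_scheme"
    and S :: "'a set"
    and n :: nat
    and M :: "nat \<Rightarrow> ('a, 'b, 'm) module_scheme"
    and K :: "nat \<Rightarrow> 'b set"
  assumes "cring R"
    and "\<one>\<^bsub>R\<^esub> \<noteq> \<zero>\<^bsub>R\<^esub>"
    and "mult_subset R S"
    and "\<And>i. i \<in> {1..n} \<Longrightarrow> module R (M i)"
    and "\<And>i. i \<in> {1..n} \<Longrightarrow> submodule (K i) R (M i)"
  shows "uS_essential R S
           (carrier (module_direct_sum {1..n} (\<lambda>i. (M i)\<lparr>carrier := K i\<rparr>)))
           (module_direct_sum {1..n} M)
         \<longleftrightarrow> (\<forall>i\<in>{1..n}. uS_essential R S (K i) (M i))"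
  by (rule uS_essential_module_direct_sum_iff[OF assms(1,3) finite_atLeastAtMost assms(4,5)])

end
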